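(* Let $L,k$ be integers with $1\le k<L$ and let $0<\lambda<1$. With $f$, $\bar{\mathcal U}$, $\mathcal U$, $\rho$ and $\bar u$ as defined in the context, let $g\in\mathcal U$ and let $u:[0,\infty)\to\bar{\mathcal U}$ be a solution of $$\dot u_j(t)=\lambda\,[f(u_{j-1}(t))-f(u_j(t))]-k\,[u_j(t)-u_{j+1}(t)],\quad j\ge1,\ t\ge0,\qquad u_0(t)=1,\qquad u(0)=g. \qquad (\ast)$$ Then: (i) $u(t)\in\mathcal U$ for all $t\ge0$. (ii) For each $j\in\mathbb{N}_0$, $\lim_{t\to\infty}(u_j(t)-\bar u_j)=0$, and thus $\lim_{t\to\infty}\rho(u(t),\bar u)=0$. In particular, $\bar u$ is the unique fixed point of the system $(\ast)$ in $\mathcal U$.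
   Context: $\mathbb{N}_0=\{0,1,2,\dots\}$. For integers $1\le k<L$, $f:[0,1]\to\mathbb{R}$ is $$f(x)=\sum_{i=1}^k\binom{L}{L-k+i}\binom{L-k+i-2}{i-1}(-1)^{i-1}x^{L-k+i},$$ with $\binom{0}{0}=1$ and $\binom ab=0$ for $a<b$. $\bar{\mathcal U}=\{u=(u_i)_{i\in\mathbb{N}_0}\in\mathbb{R}_+^\infty : 1=u_0\ge u_1\ge u_2\ge\cdots\ge0\}$, with the product metric $\rho(x,y)=\sum_{j=1}^\infty 2^{-j}|x_j-y_j|$. For $u\in\bar{\mathcal U}$, $v_1(u)=\sum_{i=1}^\infty u_i$, and $\mathcal U=\{u\in\bar{\mathcal U}: v_1(u)<\infty\}$. The sequence $\bar u=(\bar u_m)_{m\in\mathbb{N}_0}$ is defined recursively by $\bar u_0=1$ and $\bar u_{m+1}=\lambda f(\bar u_m)/k$ for $m\in\mathbb{N}_0$ (for $\lambda<1$ one has $\bar u\in\mathcal U$). A fixed point of the system in $\mathcal U$ is a point $p\in\mathcal U$ such that the constant function $u(t)\equiv p$ satisfies the differential equations. *)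

theory Defs
  imports "HOL-Analysis.Analysis"
begin

text \<open>The function \<open>f\<close> is only evaluated on \<open>[0,1]\<close>. For \<open>1 \<le> k < L\<close> and \<open>1 \<le> i \<le> k\<close>
  no natural-number subtraction below truncates.\<close>

definition f_poly :: "nat \<Rightarrow> nat \<Rightarrow> real \<Rightarrow> real" where
  "f_poly L k x = (\<Sum>i=1..k. real (L choose (L - k + i)) * real ((L - k + i - 2) choose (i - 1))
                     * (-1) ^ (i - 1) * x ^ (L - k + i))"

definition Ubar :: "(nat \<Rightarrow> real) set" where
  "Ubar = {u. u 0 = 1 \<and> (\<forall>i. u (Suc i) \<le> u i) \<and> (\<forall>i. 0 \<le> u i)}"

text \<open>The sums over \<open>j \<ge> 1\<close> are shifted to start at \<open>0\<close>. The series in \<open>rho\<close> converges for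
  all arguments in \<open>Ubar\<close>; \<open>v1\<close> takes values in \<open>[0,\<infinity>]\<close>.\<close>

definition rho :: "(nat \<Rightarrow> real) \<Rightarrow> (nat \<Rightarrow> real) \<Rightarrow> real" where
  "rho x y = (\<Sum>j. \<bar>x (Suc j) - y (Suc j)\<bar> / 2 ^ Suc j)"

definition v1 :: "(nat \<Rightarrow> real) \<Rightarrow> ennreal" where
  "v1 u = (\<Sum>i. ennreal (u (Suc i)))"

definition U :: "(nat \<Rightarrow> real) set" where
  "U = {u \<in> Ubar. v1 u < \<infinity>}"

primrec u_bar :: "nat \<Rightarrow> nat \<Rightarrow> real \<Rightarrow> nat \<Rightarrow> real" where
  "u_bar L k lam 0 = 1"
| "u_bar L k lam (Suc m) = lam * f_poly L k (u_bar L k lam m) / real k"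

text \<open>The derivative at \<open>t = 0\<close> is one-sided.\<close>

definition satisfies_ode :: "nat \<Rightarrow> nat \<Rightarrow> real \<Rightarrow> (real \<Rightarrow> nat \<Rightarrow> real) \<Rightarrow> bool" where
  "satisfies_ode L k lam u \<longleftrightarrow>
     (\<forall>t\<ge>0. u t 0 = 1) \<and>
     (\<forall>j\<ge>1. \<forall>t\<ge>0.
        ((\<lambda>s. u s j) has_real_derivative
           lam * (f_poly L k (u t (j - 1)) - f_poly L k (u t j)) - real k * (u t j - u t (j + 1)))
        (at t within {0..}))"

definition is_solution ::
  "nat \<Rightarrow> nat \<Rightarrow> real \<Rightarrow> (nat \<Rightarrow> real) \<Rightarrow> (real \<Rightarrow> nat \<Rightarrow> real) \<Rightarrow> bool" where
  "is_solution L k lam g u \<longleftrightarrow>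
     (\<forall>t\<ge>0. u t \<in> Ubar) \<and> satisfies_ode L k lam u \<and> u 0 = g"

definition is_fixed_point :: "nat \<Rightarrow> nat \<Rightarrow> real \<Rightarrow> (nat \<Rightarrow> real) \<Rightarrow> bool" where
  "is_fixed_point L k lam p \<longleftrightarrow> p \<in> U \<and> satisfies_ode L k lam (\<lambda>t. p)"

end

theory Submission
  imports Defs
begin

text \<open>The proof is an \<open>\<ell>\<^sup>1\<close> contraction argument. Put \<open>e\<^sub>j = u\<^sub>j - p\<^sub>j\<close>, where \<open>p\<close> denotes the
  sequence \<open>u_bar\<close>, and \<open>\<phi>\<^sub>j = f(u\<^sub>j) - f(p\<^sub>j)\<close>. Since \<open>f\<close> is increasing on \<open>[0,1]\<close>, \<open>\<phi>\<^sub>j\<close> has the sign of \<open>e\<^sub>j\<close>,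
  so \<open>|e\<^sub>j|' \<le> \<lambda> (|\<phi>\<^bsub>j-1\<^esub>| - |\<phi>\<^sub>j|) - k (|e\<^sub>j| - |e\<^bsub>j+1\<^esub>|)\<close>. Summing over \<open>j \<ge> n\<close>
  telescopes and gives \<open>k \<integral>|e\<^sub>n| \<le> \<Sum>\<^bsub>j\<ge>n\<^esub> |e\<^sub>j(0)| + \<lambda> \<integral>|\<phi>\<^bsub>n-1\<^esub>|\<close>. As \<open>\<phi>\<^sub>0 = 0\<close> and \<open>f\<close> is
  Lipschitz, induction on \<open>n\<close> shows that every \<open>e\<^sub>n\<close> is integrable over \<open>[0,\<infinity>)\<close>; being Lipschitz in
  time, it tends to \<open>0\<close>. A fixed point is a constant solution, which gives uniqueness.\<close>

subsection \<open>The polynomial \<open>f\<close>\<close>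

text \<open>Writing \<open>k = Suc m\<close> and \<open>L = e + m + 2\<close> removes every
  truncated subtraction; the summation index becomes \<open>n = i - 1\<close>.\<close>

lemma f_poly_Suc_Suc:
  "f_poly (e + m + 2) (Suc m) x
     = (\<Sum>n\<le>m. real ((e + m + 2) choose (e + n + 2)) * real ((e + n) choose n) * (- 1) ^ n * x ^ (e + n + 2))"
  unfolding f_poly_def
  by (rule sum.reindex_bij_witness[where i = Suc and j = "\<lambda>i. i - 1"]) auto

text \<open>Vandermonde convolution: the alternating factor
  \<open>(- 1) ^ n * ((e + n) choose n)\<close> is a binomial coefficient with upper entry
  \<open>- (e + 1)\<close>, and \<open>- (e + 1) + (e + m + 2) = m + 1\<close>.\<close>

lemma f_poly_one:
  assumes "1 \<le> k" "k < L"
  shows "f_poly L k 1 = real k"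
proof -
  define m e where "m = k - 1" and "e = L - k - 1"
  have eq: "L = e + m + 2" "k = Suc m" using assms by (auto simp: m_def e_def)
  have "f_poly L k 1
      = (\<Sum>n=0..m. (- real (Suc e) gchoose n) * (real (e + m + 2) gchoose (m - n)))"
    unfolding eq f_poly_Suc_Suc atMost_atLeast0
  proof (rule sum.cong)
    fix n assume n: "n \<in> {0..m}"
    have "(e + m + 2) choose (e + n + 2) = (e + m + 2) choose (m - n)"
      using binomial_symmetric[of "e + n + 2" "e + m + 2"] n by simp
    moreover have "- real (Suc e) gchoose n = (- 1) ^ n * real ((e + n) choose n)"
      unfolding gbinomial_minus by (simp add: binomial_gbinomial add_ac)
    ultimately show "real ((e + m + 2) choose (e + n + 2)) * real ((e + n) choose n) * (- 1) ^ n
          * 1 ^ (e + n + 2)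
        = (- real (Suc e) gchoose n) * (real (e + m + 2) gchoose (m - n))"
      by (simp only: binomial_gbinomial power_one) simp
  qed simp
  also have "\<dots> = real (Suc m) gchoose m"
    by (simp add: gbinomial_Vandermonde)
  also have "\<dots> = real k"
    using binomial_gbinomial[of "Suc m" m, where ?'a = real] eq by simp
  finally show ?thesis .
qed

lemma continuous_on_f_poly: "continuous_on S h \<Longrightarrow> continuous_on S (\<lambda>t. f_poly L k (h t))"
  unfolding f_poly_def by (intro continuous_intros)

definition f_poly' :: "nat \<Rightarrow> nat \<Rightarrow> real \<Rightarrow> real" where
  "f_poly' L k x = (\<Sum>i=1..k. real (L choose (L - k + i)) * real ((L - k + i - 2) choose (i - 1))
                     * (-1) ^ (i - 1) * (real (L - k + i) * x ^ (L - k + i - 1)))"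

lemma f_poly_has_real_derivative [derivative_intros]:
  assumes "(g has_real_derivative g') (at x within S)"
  shows "((\<lambda>x. f_poly L k (g x)) has_real_derivative f_poly' L k (g x) * g') (at x within S)"
  unfolding f_poly_def f_poly'_def
  by (rule derivative_eq_intros assms refl)+
     (simp add: sum_distrib_left sum_distrib_right mult_ac)

text \<open>The polynomial \<open>f\<close> is the expectation of the positive part of \<open>X - (L - k)\<close>, where
  \<open>X\<close> is binomial with parameters \<open>L\<close> and \<open>x\<close>; hence its second derivative is a multiple of a
  binomial probability.\<close>

lemma f_poly'_has_real_derivative:
  assumes "1 \<le> k" "k < L"
  shows "(f_poly' L k has_real_derivative
    real (L * (L - 1) * ((L - 2) choose (L - k - 1))) * x ^ (L - k - 1) * (1 - x) ^ (k - 1))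
    (at x within S)"
proof -
  define m e where "m = k - 1" and "e = L - k - 1"
  have eq: "L = e + m + 2" "k = Suc m" using assms by (auto simp: m_def e_def)
  define c where "c n = real ((e + m + 2) choose (e + n + 2)) * real ((e + n) choose n) * (- 1) ^ n" for n
  have f': "f_poly' L k = (\<lambda>x. \<Sum>n\<le>m. c n * (real (e + n + 2) * x ^ (e + n + 1)))"
    unfolding f_poly'_def eq c_def
    by (rule ext, rule sum.reindex_bij_witness[where i = Suc and j = "\<lambda>i. i - 1"]) auto
  \<comment> \<open>Absorbing the factors \<open>e + n + 2\<close> and \<open>e + n + 1\<close>
    lowers the upper index to \<open>L - 2\<close>. Trinomial revision then separates
    \<open>m choose n\<close>, the only binomial depending on \<open>n\<close>, so the sum is the
    expansion of \<open>(1 - x) ^ m\<close>.\<close>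
  have coeff: "c n * (real (e + n + 2) * real (e + n + 1))
      = real (L * (L - 1) * ((L - 2) choose e)) * (real (m choose n) * (- 1) ^ n)"
    if "n \<le> m" for n
  proof -
    have L1: "L - 1 = e + m + 1" and L2: "L - 2 = e + m" using eq by auto
    define b2 b1 b0 where "b2 = (e + m + 2) choose (e + n + 2)"
      and "b1 = (e + m + 1) choose (e + n + 1)" and "b0 = (e + m) choose (e + n)"
    have b2: "(e + n + 2) * b2 = (e + m + 2) * b1"
      using Suc_times_binomial[of "e + n + 1" "e + m + 1"] by (simp add: b2_def b1_def)
    have b1: "(e + n + 1) * b1 = (e + m + 1) * b0"
      using Suc_times_binomial[of "e + n" "e + m"] by (simp add: b1_def b0_def)
    have b0: "b0 * ((e + n) choose n) = ((e + m) choose e) * (m choose n)"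
      using choose_mult[of e "e + n" "e + m"] binomial_symmetric[of n "e + n"] that by (simp add: b0_def)
    have "b2 * ((e + n) choose n) * ((e + n + 2) * (e + n + 1))
        = ((e + n + 2) * b2) * (e + n + 1) * ((e + n) choose n)"
      by (simp only: mult_ac)
    also have "\<dots> = (e + m + 2) * ((e + n + 1) * b1) * ((e + n) choose n)"
      unfolding b2 by (simp only: mult_ac)
    also have "\<dots> = (e + m + 2) * (e + m + 1) * (b0 * ((e + n) choose n))"
      unfolding b1 by (simp only: mult_ac)
    also have "\<dots> = L * (L - 1) * ((L - 2) choose e) * (m choose n)"
      unfolding b0 L1 L2 unfolding eq(1) by (simp only: mult_ac)
    finally have "real b2 * real ((e + n) choose n) * (real (e + n + 2) * real (e + n + 1))
        = real (L * (L - 1) * ((L - 2) choose e)) * real (m choose n)"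
      by (simp only: flip: of_nat_mult)
    then have "real b2 * real ((e + n) choose n) * (real (e + n + 2) * real (e + n + 1)) * (- 1) ^ n
        = real (L * (L - 1) * ((L - 2) choose e)) * real (m choose n) * (- 1) ^ n"
      by (rule arg_cong)
    then show ?thesis
      unfolding c_def b2_def by (simp only: mult_ac)
  qed
  have "(f_poly' L k has_real_derivative
      (\<Sum>n\<le>m. c n * (real (e + n + 2) * (real (e + n + 1) * x ^ (e + n))))) (at x within S)"
    unfolding f'
  proof (intro DERIV_sum DERIV_cmult)
    fix n
    show "((\<lambda>x. x ^ (e + n + 1)) has_real_derivative real (e + n + 1) * x ^ (e + n)) (at x within S)"
      using DERIV_pow[of "e + n + 1" x S] by simp
  qed
  also have "(\<Sum>n\<le>m. c n * (real (e + n + 2) * (real (e + n + 1) * x ^ (e + n))))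
      = (\<Sum>n\<le>m. real (L * (L - 1) * ((L - 2) choose e)) * x ^ e * (real (m choose n) * (- x) ^ n))"
  proof (rule sum.cong)
    fix n assume "n \<in> {..m}"
    then have "c n * (real (e + n + 2) * real (e + n + 1)) * x ^ (e + n)
      = real (L * (L - 1) * ((L - 2) choose e)) * (real (m choose n) * (- 1) ^ n) * x ^ (e + n)"
      using coeff by simp
    then show "c n * (real (e + n + 2) * (real (e + n + 1) * x ^ (e + n)))
      = real (L * (L - 1) * ((L - 2) choose e)) * x ^ e * (real (m choose n) * (- x) ^ n)"
      by (simp only: power_add power_minus[of x n] mult_ac)
  qed simp
  also have "\<dots> = real (L * (L - 1) * ((L - 2) choose e)) * x ^ e * (1 - x) ^ m"
    using binomial_ring[of "- x" 1 m] by (simp add: sum_distrib_left)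
  finally show ?thesis using eq by simp
qed

section \<open>Monotonicity, Lipschitz and chord bounds for \<open>f_poly\<close> on the unit
  interval\<close>

lemma f_poly_zero: "k < L \<Longrightarrow> f_poly L k 0 = 0"
  by (auto simp: f_poly_def intro!: sum.neutral)

lemma f_poly'_zero: "k < L \<Longrightarrow> f_poly' L k 0 = 0"
  by (auto simp: f_poly'_def intro!: sum.neutral)

text \<open>The second derivative is nonnegative on the unit interval. Together with
  \<open>f_poly'_zero\<close> this makes \<open>f_poly\<close> increasing there, with Lipschitz
  constant \<open>f_poly' L k 1\<close>.\<close>

lemma f_poly'_mono:
  assumes "1 \<le> k" "k < L" "0 \<le> x" "x \<le> y" "y \<le> 1"
  shows "f_poly' L k x \<le> f_poly' L k y"
proof (rule DERIV_nonneg_imp_nondecreasing[OF \<open>x \<le> y\<close>])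
  fix z assume "x \<le> z" "z \<le> y"
  then have "real (L * (L - 1) * ((L - 2) choose (L - k - 1))) * z ^ (L - k - 1) * (1 - z) ^ (k - 1) \<ge> 0"
    using assms by (intro mult_nonneg_nonneg zero_le_power) auto
  with f_poly'_has_real_derivative[OF assms(1,2)]
  show "\<exists>D. (f_poly' L k has_real_derivative D) (at z) \<and> 0 \<le> D" by blast
qed

lemma f_poly'_nonneg:
  assumes "1 \<le> k" "k < L" "0 \<le> x" "x \<le> 1"
  shows "0 \<le> f_poly' L k x"
  using f_poly'_mono[of k L 0 x] f_poly'_zero[of k L] assms by simp

lemma f_poly_mono:
  assumes "1 \<le> k" "k < L" "0 \<le> x" "x \<le> y" "y \<le> 1"
  shows "f_poly L k x \<le> f_poly L k y"
proof (rule DERIV_nonneg_imp_nondecreasing[OF \<open>x \<le> y\<close>])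
  fix z assume "x \<le> z" "z \<le> y"
  then show "\<exists>D. (f_poly L k has_real_derivative D) (at z) \<and> 0 \<le> D"
    using f_poly_has_real_derivative[OF DERIV_ident] f_poly'_nonneg[of k L z] assms by force
qed

lemma f_poly_lipschitz:
  assumes "1 \<le> k" "k < L" "x \<in> {0..1}" "y \<in> {0..1}"
  shows "\<bar>f_poly L k x - f_poly L k y\<bar> \<le> f_poly' L k 1 * \<bar>x - y\<bar>"
proof -
  have "norm (f_poly L k x - f_poly L k y) \<le> f_poly' L k 1 * norm (x - y)"
  proof (rule field_differentiable_bound[where S = "{0..1}" and f' = "f_poly' L k"])
    fix z :: real assume z: "z \<in> {0..1}"
    show "(f_poly L k has_field_derivative f_poly' L k z) (at z within {0..1})"
      using f_poly_has_real_derivative[OF DERIV_ident] by simp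
    show "norm (f_poly' L k z) \<le> f_poly' L k 1"
      using f_poly'_mono[of k L z 1] f_poly'_nonneg[of k L z] z assms by simp
  qed (use assms in auto)
  then show ?thesis by simp
qed

text \<open>A convex function lies below its chord, here from (0,0) to (1,k). It turns the recursion
  for \<open>u_bar\<close> into geometric decay with ratio \<open>lam\<close>.\<close>

lemma f_poly_le:
  assumes "1 \<le> k" "k < L" "0 \<le> x" "x \<le> 1"
  shows "f_poly L k x \<le> real k * x"
proof -
  have "convex_on {0..1} (f_poly L k)"
  proof (rule f''_ge0_imp_convex)
    fix z :: real assume z: "z \<in> {0..1}"
    show "DERIV (f_poly L k) z :> f_poly' L k z"
      using f_poly_has_real_derivative[OF DERIV_ident] by simp
    show "DERIV (f_poly' L k) z :>
        real (L * (L - 1) * ((L - 2) choose (L - k - 1))) * z ^ (L - k - 1) * (1 - z) ^ (k - 1)"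
      using assms by (intro f_poly'_has_real_derivative)
    show "0 \<le> real (L * (L - 1) * ((L - 2) choose (L - k - 1))) * z ^ (L - k - 1) * (1 - z) ^ (k - 1)"
      using z by (intro mult_nonneg_nonneg zero_le_power) auto
  qed simp
  from convex_onD[OF this, of x 0 1] show ?thesis
    using assms f_poly_zero f_poly_one by (simp add: mult.commute)
qed

subsection \<open>Differential inequalities on the half-line\<close>

text \<open>Two-sided derivatives exist only for positive times; at the end point 0 continuity
  suffices.\<close>

lemma DERIV_nonpos_halfline_imp_le:
  fixes w :: "real \<Rightarrow> real"
  assumes deriv: "\<And>s. 0 \<le> s \<Longrightarrow> (w has_real_derivative w' s) (at s within {0..})"
    and le: "\<And>s. 0 \<le> s \<Longrightarrow> w' s \<le> 0" and "0 \<le> s" "s \<le> t"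
  shows "w t \<le> w s"
proof (rule DERIV_nonpos_imp_decreasing_open[OF \<open>s \<le> t\<close>])
  fix x assume "s < x" "x < t"
  then have "at x within {0..} = at x"
    using \<open>0 \<le> s\<close> by (intro at_within_interior) (simp add: interior_real_atLeast)
  with deriv[of x] le[of x] show "\<exists>y. DERIV w x :> y \<and> y \<le> 0"
    using \<open>s < x\<close> \<open>0 \<le> s\<close> by auto
next
  have "continuous_on {0..} w"
    using deriv by (intro DERIV_continuous_on[where D = w']) auto
  then show "continuous_on {s..t} w"
    using \<open>0 \<le> s\<close> by (elim continuous_on_subset) auto
qed

lemma integral_has_real_derivative_halfline:
  assumes "continuous_on {0..} h" "0 \<le> t"
  shows "((\<lambda>x. integral {0..x} h) has_real_derivative h t) (at t within {0..})"
proof -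
  \<comment> \<open>The \<open>+ 1\<close> leaves room to the right of \<open>t\<close>, so that the
    filter at \<open>t\<close> is that of the half-line.\<close>
  have "((\<lambda>x. integral {0..x} h) has_real_derivative h t) (at t within {0..t + 1})"
    using assms by (intro integral_has_real_derivative continuous_on_subset[OF assms(1)]) auto
  also have "at t within {0..t + 1} = at t within {0..}"
    by (rule at_within_nhd[of _ "{..<t + 1}"]) auto
  finally show ?thesis .
qed

text \<open>The absolute value is not differentiable at \<open>0\<close>; it is approximated by
  \<open>sqrt (e\<^sup>2 + \<epsilon>\<^sup>2)\<close>.\<close>

lemma abs_increment_le:
  fixes e a b p P :: "real \<Rightarrow> real"
  assumes de: "\<And>t. 0 \<le> t \<Longrightarrow> (e has_real_derivative a t - b t) (at t within {0..})"
    and dP: "\<And>t. 0 \<le> t \<Longrightarrow> (P has_real_derivative p t) (at t within {0..})"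
    and p: "\<And>t. 0 \<le> t \<Longrightarrow> \<bar>a t\<bar> - \<bar>b t\<bar> \<le> p t"
    and sign: "\<And>t. 0 \<le> t \<Longrightarrow> 0 \<le> e t * b t"
    and b: "\<And>t. 0 \<le> t \<Longrightarrow> \<bar>b t\<bar> \<le> c * \<bar>e t\<bar>"
    and c: "0 \<le> c" and t: "0 \<le> t"
  shows "\<bar>e t\<bar> - \<bar>e 0\<bar> \<le> P t - P 0"
proof -
  \<comment> \<open>The slack consists of \<open>\<epsilon>\<close> from the estimate of
    \<open>h 0\<close>, and of \<open>c * \<epsilon> * t\<close> from an error of at most
    \<open>c * \<epsilon>\<close> in the derivative of \<open>h\<close>.\<close>
  have approx: "\<bar>e t\<bar> - \<bar>e 0\<bar> \<le> P t - P 0 + \<epsilon> * (1 + c * t)" if \<epsilon>: "0 < \<epsilon>" for \<epsilon>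
  proof -
    define h where "h s = sqrt ((e s)\<^sup>2 + \<epsilon>\<^sup>2)" for s
    have hpos: "0 < h s" for s
      using \<epsilon> by (simp add: h_def add_nonneg_pos)
    have h_ge: "\<bar>e s\<bar> \<le> h s" for s
      unfolding h_def by (rule real_le_rsqrt) simp
    have h_le: "h s \<le> \<bar>e s\<bar> + \<epsilon>" for s
      unfolding h_def using \<epsilon> sqrt_sum_squares_le_sum_abs[of "e s" \<epsilon>] by simp
    have dh: "(h has_real_derivative e s * (a s - b s) / h s) (at s within {0..})" if "0 \<le> s" for s
    proof -
      have pos: "0 < (e s)\<^sup>2 + \<epsilon>\<^sup>2" using \<epsilon> by (simp add: add_nonneg_pos)
      have "(h has_real_derivative inverse (sqrt ((e s)\<^sup>2 + \<epsilon>\<^sup>2)) / 2 * (2 * e s * (a s - b s)))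
          (at s within {0..})"
        unfolding h_def using pos
        by (intro DERIV_chain2[OF DERIV_real_sqrt]) (auto intro!: derivative_eq_intros de[OF that])
      moreover have "inverse r / 2 * (2 * x * y) = x * y / r" for r x y :: real
        by (cases "r = 0") (simp_all add: field_simps)
      ultimately show ?thesis by (simp only: h_def)
    qed
    have "h t - P t - c * \<epsilon> * t \<le> h 0 - P 0 - c * \<epsilon> * 0"
    proof (rule DERIV_nonpos_halfline_imp_le[where w = "\<lambda>s. h s - P s - c * \<epsilon> * s"])
      fix s :: real assume s: "0 \<le> s"
      show "((\<lambda>s. h s - P s - c * \<epsilon> * s) has_real_derivative
          e s * (a s - b s) / h s - p s - c * \<epsilon>) (at s within {0..})"
        by (rule DERIV_diff[OF DERIV_diff[OF dh[OF s] dP[OF s]] DERIV_cmult_Id])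
      have "e s * a s \<le> h s * \<bar>a s\<bar>"
        using mult_right_mono[OF h_ge[of s] abs_ge_zero[of "a s"]] abs_ge_self[of "e s * a s"]
        unfolding abs_mult by (rule order_trans[rotated])
      \<comment> \<open>The price of smoothing: the damping supplies only
        \<open>\<bar>e s\<bar> * \<bar>b s\<bar>\<close> in place of
        \<open>h s * \<bar>b s\<bar>\<close>. The gap is small because \<open>h s\<close> exceeds
        \<open>\<bar>e s\<bar>\<close> by at most \<open>\<epsilon>\<close>.\<close>
      moreover have "h s * \<bar>b s\<bar> - e s * b s \<le> h s * (c * \<epsilon>)"
      proof -
        have "e s * b s = \<bar>e s\<bar> * \<bar>b s\<bar>"
          using sign[OF s] by (simp flip: abs_mult)
        then have "h s * \<bar>b s\<bar> - e s * b s = (h s - \<bar>e s\<bar>) * \<bar>b s\<bar>"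
          by (simp add: algebra_simps)
        also have "\<dots> \<le> \<epsilon> * (c * h s)"
        proof (rule mult_mono)
          show "\<bar>b s\<bar> \<le> c * h s"
            using b[OF s] mult_left_mono[OF h_ge[of s] c] by (rule order_trans)
        qed (use h_le[of s] \<epsilon> in auto)
        finally show ?thesis by (simp add: mult_ac)
      qed
      ultimately have "e s * (a s - b s) \<le> h s * (\<bar>a s\<bar> - \<bar>b s\<bar> + c * \<epsilon>)"
        by (simp add: algebra_simps)
      also have "\<dots> \<le> h s * (p s + c * \<epsilon>)"
        using p[OF s] hpos[of s] by (intro mult_left_mono) auto
      finally show "e s * (a s - b s) / h s - p s - c * \<epsilon> \<le> 0"
        using hpos[of s] by (simp add: field_simps)
    qed (use t in auto)
    then show ?thesis
      using h_ge[of t] h_le[of 0] by (simp add: algebra_simps)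
  qed
  have "1 + c * t > 0" using c t by (simp add: add_pos_nonneg)
  show ?thesis
  proof (rule field_le_epsilon)
    fix \<delta> :: real assume "0 < \<delta>"
    with approx[of "\<delta> / (1 + c * t)"] \<open>1 + c * t > 0\<close>
    show "\<bar>e t\<bar> - \<bar>e 0\<bar> \<le> P t - P 0 + \<delta>" by simp
  qed
qed

text \<open>If \<open>h t\<close> is at least \<open>\<epsilon>\<close>, the bound on its rate of
  decrease keeps \<open>h\<close> above \<open>\<epsilon> / 2\<close> for a further time
  \<open>\<epsilon> / (2 * M)\<close>. Each such \<open>t\<close> costs a fixed amount of integral,
  which the bound \<open>K\<close> forbids at late times.\<close>

lemma barbalat:
  fixes h :: "real \<Rightarrow> real"
  assumes lip: "\<And>s t. 0 \<le> s \<Longrightarrow> s \<le> t \<Longrightarrow> h s - h t \<le> M * (t - s)" and M: "0 < M"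
    and cont: "continuous_on {0..} h"
    and nonneg: "\<And>t. 0 \<le> t \<Longrightarrow> 0 \<le> h t"
    and bound: "\<And>t. 0 \<le> t \<Longrightarrow> integral {0..t} h \<le> K"
  shows "(h \<longlongrightarrow> 0) at_top"
proof (rule tendstoI)
  fix \<epsilon> :: real assume \<epsilon>: "0 < \<epsilon>"
  define A where "A t = integral {0..t} h" for t
  define \<delta> where "\<delta> = \<epsilon> / (2 * M)"
  have \<delta>: "0 < \<delta>" "M * \<delta> = \<epsilon> / 2" using \<epsilon> M by (auto simp: \<delta>_def)
  have int: "h integrable_on {a..b}" if "0 \<le> a" for a b
    using that by (intro integrable_continuous_interval continuous_on_subset[OF cont]) auto
  have split: "A t = A s + integral {s..t} h" if "0 \<le> s" "s \<le> t" for s t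
    unfolding A_def using Henstock_Kurzweil_Integration.integral_combine[of 0 s t h] int that by simp
  have A_mono: "A s \<le> A t" if "0 \<le> s" "s \<le> t" for s t
  proof -
    have "0 \<le> integral {s..t} h"
      using that int nonneg by (intro Henstock_Kurzweil_Integration.integral_nonneg) auto
    then show ?thesis using split[OF that] by simp
  qed
  have "bdd_above (A ` {0..})"
    using bound by (auto simp: A_def intro!: bdd_aboveI)
  moreover have "Sup (A ` {0..}) - \<epsilon> / 2 * \<delta> < Sup (A ` {0..})"
    using \<epsilon> \<delta> by simp
  \<comment> \<open>Beyond \<open>T\<close> less than \<open>\<epsilon> / 2 * \<delta>\<close> of
    the integral remains, the area that one value of at least \<open>\<epsilon>\<close> would
    need.\<close>
  ultimately obtain T where T: "0 \<le> T" "Sup (A ` {0..}) - \<epsilon> / 2 * \<delta> < A T"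
    using less_cSUP_iff[of "{0..}" A "Sup (A ` {0..}) - \<epsilon> / 2 * \<delta>"] by auto
  have "h t < \<epsilon>" if "T \<le> t" for t
  proof -
    have t: "0 \<le> t" using that T by simp
    have "(h t - \<epsilon> / 2) * \<delta> = integral {t..t + \<delta>} (\<lambda>_. h t - \<epsilon> / 2)"
      using \<delta> by simp
    also have "\<dots> \<le> integral {t..t + \<delta>} h"
    proof (rule integral_le)
      fix s assume s: "s \<in> {t..t + \<delta>}"
      then have "M * (s - t) \<le> M * \<delta>" using M by (intro mult_left_mono) auto
      then show "h t - \<epsilon> / 2 \<le> h s" using lip[of t s] s t \<delta> by auto
    qed (use int t in auto)
    also have "\<dots> = A (t + \<delta>) - A t"
      using split[of t "t + \<delta>"] t \<delta> by simp
    also have "\<dots> < \<epsilon> / 2 * \<delta>"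
    proof -
      have "A (t + \<delta>) \<le> Sup (A ` {0..})"
        using \<open>bdd_above (A ` {0..})\<close> t \<delta> by (intro cSUP_upper) auto
      then show ?thesis using T A_mono[of T t] that by simp
    qed
    finally show ?thesis using \<delta> by simp
  qed
  then show "\<forall>\<^sub>F t in at_top. dist (h t) 0 < \<epsilon>"
    using nonneg eventually_ge_at_top[of "max 0 T"] by (force elim: eventually_mono)
qed

subsection \<open>The sequence \<open>u_bar\<close>\<close>

lemma Ubar_bounds:
  assumes "x \<in> Ubar"
  shows "0 \<le> x j" "x j \<le> 1"
proof -
  have "x j \<le> x 0"
    by (rule lift_Suc_antimono_le[of x]) (use assms in \<open>auto simp: Ubar_def\<close>)
  then show "0 \<le> x j" "x j \<le> 1" using assms by (auto simp: Ubar_def)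
qed

lemma U_iff_summable: "x \<in> U \<longleftrightarrow> x \<in> Ubar \<and> summable x"
proof -
  have "v1 x < \<infinity> \<longleftrightarrow> summable (\<lambda>i. x (Suc i))" if "x \<in> Ubar"
  proof
    assume "v1 x < \<infinity>"
    then show "summable (\<lambda>i. x (Suc i))"
      using Ubar_bounds[OF that] by (intro summable_suminf_not_top) (auto simp: v1_def)
  next
    assume "summable (\<lambda>i. x (Suc i))"
    then show "v1 x < \<infinity>"
      using Ubar_bounds[OF that] by (simp add: v1_def suminf_ennreal2)
  qed
  then show ?thesis by (auto simp: U_def summable_Suc_iff)
qed

lemma f_poly_bounds:
  assumes "1 \<le> k" "k < L" "0 \<le> x" "x \<le> 1"
  shows "0 \<le> f_poly L k x" "f_poly L k x \<le> real k"
proof -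
  show "0 \<le> f_poly L k x"
    using f_poly_mono[of k L 0 x] f_poly_zero[of k L] assms by simp
  show "f_poly L k x \<le> real k"
    using f_poly_mono[of k L x 1] f_poly_one[of k L] assms by simp
qed

text \<open>The flux balance of the stationary state: it annihilates the right-hand side at
  \<open>u_bar\<close> and removes \<open>u_bar\<close> from the equation for the error.\<close>

lemma u_bar_step:
  assumes "1 \<le> k"
  shows "lam * f_poly L k (u_bar L k lam j) = real k * u_bar L k lam (Suc j)"
  using assms by simp

lemma u_bar_contract:
  assumes "1 \<le> k" "k < L" "0 < lam" "lam < 1"
  shows "u_bar L k lam j \<in> {0..1}" "u_bar L k lam (Suc j) \<le> lam * u_bar L k lam j"
proof -
  have step: "0 \<le> lam * f_poly L k x / real k" "lam * f_poly L k x / real k \<le> lam * x"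
    if "x \<in> {0..1}" for x
    using f_poly_le[of k L x] f_poly_bounds[of k L x] that assms by (auto simp: field_simps)
  show range: "u_bar L k lam j \<in> {0..1}"
  proof (induction j)
    case (Suc j)
    have "lam * u_bar L k lam j \<le> 1"
      using Suc assms by (intro mult_le_one) auto
    with step[OF Suc] show ?case
      unfolding u_bar.simps atLeastAtMost_iff by linarith
  qed simp
  show "u_bar L k lam (Suc j) \<le> lam * u_bar L k lam j"
    using step[OF range] by simp
qed

lemma u_bar_in_U:
  assumes "1 \<le> k" "k < L" "0 < lam" "lam < 1"
  shows "u_bar L k lam \<in> U"
proof -
  note * = u_bar_contract[OF assms]
  have "u_bar L k lam (Suc j) \<le> u_bar L k lam j" for j
    using *[of j] assms mult_right_mono[of lam 1 "u_bar L k lam j"] by force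
  moreover have "summable (u_bar L k lam)"
  proof (rule summable_ratio_test)
    show "norm (u_bar L k lam (Suc n)) \<le> lam * norm (u_bar L k lam n)" for n
      using *(1)[of n] *(1)[of "Suc n"] *(2)[of n] by (simp del: u_bar.simps)
  qed (use assms in auto)
  ultimately show ?thesis
    using *(1) by (auto simp: U_iff_summable Ubar_def simp del: u_bar.simps(2))
qed

lemma is_fixed_point_u_bar:
  assumes "1 \<le> k" "k < L" "0 < lam" "lam < 1"
  shows "is_fixed_point L k lam (u_bar L k lam)"
proof -
  have "lam * (f_poly L k (u_bar L k lam (j - 1)) - f_poly L k (u_bar L k lam j))
      - real k * (u_bar L k lam j - u_bar L k lam (j + 1)) = 0" if "1 \<le> j" for j
    using u_bar_step[OF assms(1), of lam L "j - 1"] u_bar_step[OF assms(1), of lam L j] that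
    by (simp add: algebra_simps del: u_bar.simps)
  then show ?thesis
    using u_bar_in_U[OF assms] by (simp add: is_fixed_point_def satisfies_ode_def del: u_bar.simps(2))
qed

subsection \<open>Solutions\<close>

text \<open>A locale, because it is interpreted twice: for the given solution, and for a fixed point
  viewed as a constant solution.\<close>

locale solution =
  fixes L k :: nat and lam :: real and g :: "nat \<Rightarrow> real" and u :: "real \<Rightarrow> nat \<Rightarrow> real"
  assumes k: "1 \<le> k" "k < L" and lam: "0 < lam" "lam < 1"
    and initial: "g \<in> U" and sol: "is_solution L k lam g u"
begin

section \<open>Elementary properties of a solution and summability at every time\<close>

lemma in_Ubar: "0 \<le> t \<Longrightarrow> u t \<in> Ubar"
  and at_0: "u 0 = g"
  using sol by (auto simp: is_solution_def)

lemmas bounds = Ubar_bounds[OF in_Ubar]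

lemma u_0: "0 \<le> t \<Longrightarrow> u t 0 = 1"
  using in_Ubar by (auto simp: Ubar_def)

lemma ode:
  assumes "0 \<le> t"
  shows "((\<lambda>s. u s (Suc j)) has_real_derivative
     lam * (f_poly L k (u t j) - f_poly L k (u t (Suc j))) - real k * (u t (Suc j) - u t (Suc (Suc j))))
   (at t within {0..})"
proof -
  have "1 \<le> Suc j" by simp
  with sol assms have "((\<lambda>s. u s (Suc j)) has_real_derivative
     lam * (f_poly L k (u t (Suc j - 1)) - f_poly L k (u t (Suc j)))
       - real k * (u t (Suc j) - u t (Suc j + 1))) (at t within {0..})"
    unfolding is_solution_def satisfies_ode_def by blast
  then show ?thesis by simp
qed

text \<open>The first \<open>n\<close> equations telescope, leaving boundary fluxes of at most
  \<open>k\<close> each. The bound is uniform in \<open>n\<close>, and only finite sums are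
  differentiated.\<close>

lemma partial_sum_le:
  assumes "0 \<le> t"
  shows "(\<Sum>j<n. u t (Suc j)) \<le> (\<Sum>j. g (Suc j)) + 2 * real k * t"
proof -
  have "(\<Sum>j<n. u t (Suc j)) - 2 * real k * t \<le> (\<Sum>j<n. u 0 (Suc j)) - 2 * real k * 0"
  proof (rule DERIV_nonpos_halfline_imp_le[where w = "\<lambda>s. (\<Sum>j<n. u s (Suc j)) - 2 * real k * s"])
    fix s :: real assume s: "0 \<le> s"
    show "((\<lambda>s. (\<Sum>j<n. u s (Suc j)) - 2 * real k * s) has_real_derivative
      (\<Sum>j<n. lam * (f_poly L k (u s j) - f_poly L k (u s (Suc j)))
         - real k * (u s (Suc j) - u s (Suc (Suc j)))) - 2 * real k) (at s within {0..})"
      by (auto intro!: derivative_eq_intros ode s)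
    have "(\<Sum>j<n. lam * (f_poly L k (u s j) - f_poly L k (u s (Suc j)))
         - real k * (u s (Suc j) - u s (Suc (Suc j))))
      = lam * (f_poly L k (u s 0) - f_poly L k (u s n)) - real k * (u s (Suc 0) - u s (Suc n))"
      using sum_lessThan_telescope'[of "\<lambda>j. f_poly L k (u s j)" n]
        sum_lessThan_telescope'[of "\<lambda>j. u s (Suc j)" n]
      by (simp add: sum_subtractf flip: sum_distrib_left)
    also have "\<dots> \<le> 1 * real k - real k * (0 - 1)"
    proof (rule diff_mono)
      have "lam * (f_poly L k (u s 0) - f_poly L k (u s n)) \<le> lam * real k"
        using f_poly_bounds[OF k bounds[OF s], of 0] f_poly_bounds[OF k bounds[OF s], of n] lam
        by (intro mult_left_mono) linarith+
      also have "\<dots> \<le> 1 * real k" using lam by (intro mult_right_mono) auto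
      finally show "lam * (f_poly L k (u s 0) - f_poly L k (u s n)) \<le> 1 * real k" .
      show "real k * (0 - 1) \<le> real k * (u s (Suc 0) - u s (Suc n))"
        using bounds[OF s] by (intro mult_left_mono diff_mono) auto
    qed
    finally show "(\<Sum>j<n. lam * (f_poly L k (u s j) - f_poly L k (u s (Suc j)))
         - real k * (u s (Suc j) - u s (Suc (Suc j)))) - 2 * real k \<le> 0" by simp
  qed (use assms in auto)
  moreover have "(\<Sum>j<n. g (Suc j)) \<le> (\<Sum>j. g (Suc j))"
    using initial Ubar_bounds[of g] by (intro sum_le_suminf) (auto simp: U_iff_summable summable_Suc_iff)
  ultimately show ?thesis by (simp add: at_0)
qed

lemma in_U:
  assumes "0 \<le> t"
  shows "u t \<in> U"
proof -
  have "summable (\<lambda>j. u t (Suc j))"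
    using partial_sum_le[OF assms] bounds[OF assms] by (intro summableI_nonneg_bounded) auto
  then show ?thesis using in_Ubar[OF assms] by (simp add: U_iff_summable summable_Suc_iff)
qed

text \<open>In a nonincreasing sequence the last of \<open>Suc n\<close> terms is at most their
  average. The resulting decay in \<open>n\<close> is uniform over bounded time intervals.\<close>

lemma le_inverse:
  assumes "0 \<le> t"
  shows "u t (Suc n) \<le> ((\<Sum>j. g (Suc j)) + 2 * real k * t) / real (Suc n)"
proof -
  have "real (Suc n) * u t (Suc n) = (\<Sum>j<Suc n. u t (Suc n))" by simp
  also have "\<dots> \<le> (\<Sum>j<Suc n. u t (Suc j))"
  proof (rule sum_mono, rule lift_Suc_antimono_le[of "u t"])
    show "u t (Suc i) \<le> u t i" for i using in_Ubar[OF assms] by (auto simp: Ubar_def)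
  qed auto
  also note partial_sum_le[OF assms]
  finally show ?thesis by (simp add: field_simps)
qed

lemma continuous: "continuous_on {0..} (\<lambda>t. u t j)"
proof (cases j)
  case 0
  then show ?thesis using continuous_on_cong[of "{0..}" "{0..}" "\<lambda>t. u t 0" "\<lambda>_. 1"] u_0 by simp
next
  case (Suc i)
  then show ?thesis using ode[of _ i] by (intro DERIV_continuous_on[where D = "\<lambda>t. _ t"]) auto
qed

section \<open>The deviation from \<open>u_bar\<close> and its time integrals\<close>

definition err :: "nat \<Rightarrow> real \<Rightarrow> real" where
  "err j t = u t j - u_bar L k lam j"

definition ferr :: "nat \<Rightarrow> real \<Rightarrow> real" where
  "ferr j t = f_poly L k (u t j) - f_poly L k (u_bar L k lam j)"

definition err_int :: "nat \<Rightarrow> real \<Rightarrow> real" where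
  "err_int j t = integral {0..t} (\<lambda>s. \<bar>err j s\<bar>)"

definition ferr_int :: "nat \<Rightarrow> real \<Rightarrow> real" where
  "ferr_int j t = integral {0..t} (\<lambda>s. \<bar>ferr j s\<bar>)"

lemma u_bar_range: "0 \<le> u_bar L k lam j" "u_bar L k lam j \<le> 1"
  using u_bar_contract[OF k lam] by (auto simp del: u_bar.simps)

lemma continuous_abs_err: "continuous_on {0..} (\<lambda>t. \<bar>err j t\<bar>)"
  unfolding err_def by (intro continuous_intros continuous)

lemma continuous_abs_ferr: "continuous_on {0..} (\<lambda>t. \<bar>ferr j t\<bar>)"
  unfolding ferr_def by (intro continuous_intros continuous_on_f_poly continuous)

lemma ferr_le: "0 \<le> t \<Longrightarrow> \<bar>ferr j t\<bar> \<le> f_poly' L k 1 * \<bar>err j t\<bar>"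
  unfolding ferr_def err_def using f_poly_lipschitz[OF k] bounds u_bar_range by simp

lemma err_ferr_sign: "0 \<le> t \<Longrightarrow> 0 \<le> err j t * ferr j t"
  using f_poly_mono[OF k, of "u t j" "u_bar L k lam j"] f_poly_mono[OF k, of "u_bar L k lam j" "u t j"]
    bounds[of t j] u_bar_range[of j]
  by (cases "u t j" "u_bar L k lam j" rule: le_cases)
     (auto simp: err_def ferr_def zero_le_mult_iff simp del: u_bar.simps)

text \<open>The terms are grouped as \<open>abs_increment_le\<close> requires: a gain from the two
  neighbouring coordinates minus a loss in the coordinate itself, which has the sign of
  \<open>err (Suc j)\<close>.\<close>

lemma err_has_real_derivative:
  assumes "0 \<le> t"
  shows "(err (Suc j) has_real_derivative
    (lam * ferr j t + real k * err (Suc (Suc j)) t) - (lam * ferr (Suc j) t + real k * err (Suc j) t))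
    (at t within {0..})"
proof -
  have "(err (Suc j) has_real_derivative
     lam * (f_poly L k (u t j) - f_poly L k (u t (Suc j))) - real k * (u t (Suc j) - u t (Suc (Suc j))))
     (at t within {0..})"
    unfolding err_def using ode[OF assms, of j] by (auto intro!: derivative_eq_intros simp del: u_bar.simps)
  then show ?thesis
    using u_bar_step[OF k(1), of lam L j] u_bar_step[OF k(1), of lam L "Suc j"]
    by (simp add: err_def ferr_def algebra_simps del: u_bar.simps)
qed

lemma abs_err_increment_le:
  assumes "0 \<le> t"
  shows "\<bar>err (Suc j) t\<bar> - \<bar>err (Suc j) 0\<bar>
    \<le> lam * (ferr_int j t - ferr_int (Suc j) t) - real k * (err_int (Suc j) t - err_int (Suc (Suc j)) t)"
proof -
  define P where "P t = lam * (ferr_int j t - ferr_int (Suc j) t)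
      - real k * (err_int (Suc j) t - err_int (Suc (Suc j)) t)" for t
  have deriv: "(err_int i has_real_derivative \<bar>err i s\<bar>) (at s within {0..})"
      "(ferr_int i has_real_derivative \<bar>ferr i s\<bar>) (at s within {0..})" if "0 \<le> s" for i s
    unfolding err_int_def ferr_int_def
    using integral_has_real_derivative_halfline continuous_abs_err continuous_abs_ferr that by auto
  have "\<bar>err (Suc j) t\<bar> - \<bar>err (Suc j) 0\<bar> \<le> P t - P 0"
  proof (rule abs_increment_le)
    fix s :: real assume s: "0 \<le> s"
    show "(err (Suc j) has_real_derivative
      (lam * ferr j s + real k * err (Suc (Suc j)) s) - (lam * ferr (Suc j) s + real k * err (Suc j) s))
      (at s within {0..})"
      by (rule err_has_real_derivative[OF s])
    show "(P has_real_derivative lam * (\<bar>ferr j s\<bar> - \<bar>ferr (Suc j) s\<bar>)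
      - real k * (\<bar>err (Suc j) s\<bar> - \<bar>err (Suc (Suc j)) s\<bar>)) (at s within {0..})"
      unfolding P_def by (auto intro!: derivative_eq_intros deriv s)
    \<comment> \<open>Both summands of the loss share a sign, so its absolute value splits exactly.
      Only the gain needs the triangle inequality, and hence the bound telescopes in
      \<open>j\<close>.\<close>
    have same: "\<bar>lam * ferr (Suc j) s + real k * err (Suc j) s\<bar>
        = lam * \<bar>ferr (Suc j) s\<bar> + real k * \<bar>err (Suc j) s\<bar>"
    proof (cases "0 \<le> err (Suc j) s \<and> 0 \<le> ferr (Suc j) s")
      case True
      then show ?thesis using lam by simp
    next
      case False
      then have "err (Suc j) s \<le> 0" "ferr (Suc j) s \<le> 0"
        using err_ferr_sign[OF s, of "Suc j"] ferr_le[OF s, of "Suc j"] by (auto simp: zero_le_mult_iff)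
      moreover from this have "lam * ferr (Suc j) s + real k * err (Suc j) s \<le> 0"
        using lam by (intro add_nonpos_nonpos mult_nonneg_nonpos) auto
      ultimately show ?thesis by simp
    qed
    have "\<bar>lam * ferr j s + real k * err (Suc (Suc j)) s\<bar>
        \<le> lam * \<bar>ferr j s\<bar> + real k * \<bar>err (Suc (Suc j)) s\<bar>"
      using abs_triangle_ineq[of "lam * ferr j s" "real k * err (Suc (Suc j)) s"] lam by (simp add: abs_mult)
    then show "\<bar>lam * ferr j s + real k * err (Suc (Suc j)) s\<bar>
        - \<bar>lam * ferr (Suc j) s + real k * err (Suc j) s\<bar>
      \<le> lam * (\<bar>ferr j s\<bar> - \<bar>ferr (Suc j) s\<bar>)
        - real k * (\<bar>err (Suc j) s\<bar> - \<bar>err (Suc (Suc j)) s\<bar>)"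
      unfolding same by (simp add: algebra_simps)
    show "0 \<le> err (Suc j) s * (lam * ferr (Suc j) s + real k * err (Suc j) s)"
    proof -
      have "0 \<le> lam * (err (Suc j) s * ferr (Suc j) s) + real k * (err (Suc j) s * err (Suc j) s)"
        using mult_nonneg_nonneg[OF _ err_ferr_sign[OF s, of "Suc j"], of lam] lam by simp
      then show ?thesis by (simp add: algebra_simps)
    qed
    show "\<bar>lam * ferr (Suc j) s + real k * err (Suc j) s\<bar>
        \<le> (lam * f_poly' L k 1 + real k) * \<bar>err (Suc j) s\<bar>"
      unfolding same using mult_left_mono[OF ferr_le[OF s, of "Suc j"], of lam] lam
      by (simp add: algebra_simps)
  qed (use assms lam f_poly'_nonneg[OF k, of 1] in auto)
  then show ?thesis by (simp add: P_def err_int_def ferr_int_def)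
qed

section \<open>Bounds on the integrated deviation, uniform in time\<close>

lemma summable_err_0: "summable (\<lambda>j. \<bar>err j 0\<bar>)"
proof (rule summable_comparison_test')
  show "summable (\<lambda>j. g j + u_bar L k lam j)"
    using initial u_bar_in_U[OF k lam] by (intro summable_add) (auto simp: U_iff_summable)
  show "norm \<bar>err j 0\<bar> \<le> g j + u_bar L k lam j" for j
    using bounds[of 0 j] u_bar_range[of j] by (simp add: err_def at_0)
qed

text \<open>This disposes of the boundary term at infinity in the telescoped sum. For fixed
  \<open>t\<close> the integrand is dominated on \<open>{0..t}\<close> by the
  \<open>le_inverse\<close> bound at time \<open>t\<close> plus a term of the summable sequence
  \<open>u_bar\<close>.\<close>

lemma err_int_tendsto_0:
  assumes t: "0 \<le> t"
  shows "(\<lambda>n. err_int n t) \<longlonglongrightarrow> 0"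
proof -
  define K where "K = (\<Sum>j. g (Suc j)) + 2 * real k * t"
  have "(\<lambda>n. err_int (Suc n) t) \<longlonglongrightarrow> 0"
  proof (rule tendsto_sandwich)
    show "\<forall>\<^sub>F n in sequentially. 0 \<le> err_int (Suc n) t"
      unfolding err_int_def
      by (intro always_eventually allI Henstock_Kurzweil_Integration.integral_nonneg
          integrable_continuous_interval continuous_on_subset[OF continuous_abs_err]) auto
    show "\<forall>\<^sub>F n in sequentially. err_int (Suc n) t \<le> t * (K / real (Suc n) + u_bar L k lam (Suc n))"
    proof (intro always_eventually allI)
      fix n
      have "err_int (Suc n) t \<le> integral {0..t} (\<lambda>_. K / real (Suc n) + u_bar L k lam (Suc n))"
        unfolding err_int_def
      proof (rule integral_le)
        fix s assume s: "s \<in> {0..t}"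
        have "\<bar>err (Suc n) s\<bar> \<le> u s (Suc n) + u_bar L k lam (Suc n)"
          unfolding err_def using bounds[of s "Suc n"] u_bar_range[of "Suc n"] s by (simp del: u_bar.simps)
        also have "u s (Suc n) \<le> ((\<Sum>j. g (Suc j)) + 2 * real k * s) / real (Suc n)"
          using s by (intro le_inverse) auto
        also have "\<dots> \<le> K / real (Suc n)"
          unfolding K_def using s by (intro divide_right_mono add_left_mono mult_left_mono) auto
        finally show "\<bar>err (Suc n) s\<bar> \<le> K / real (Suc n) + u_bar L k lam (Suc n)" by simp
      qed (auto intro!: integrable_continuous_interval continuous_on_subset[OF continuous_abs_err])
      then show "err_int (Suc n) t \<le> t * (K / real (Suc n) + u_bar L k lam (Suc n))"
        using t by (simp del: u_bar.simps)
    qed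
    have "(\<lambda>n. K / real (Suc n)) \<longlonglongrightarrow> 0"
      using LIMSEQ_Suc[OF lim_const_over_n[of K]] by simp
    moreover have "(\<lambda>n. u_bar L k lam (Suc n)) \<longlonglongrightarrow> 0"
      using u_bar_in_U[OF k lam]
      by (intro LIMSEQ_Suc summable_LIMSEQ_zero) (auto simp: U_iff_summable)
    ultimately show "(\<lambda>n. t * (K / real (Suc n) + u_bar L k lam (Suc n))) \<longlonglongrightarrow> 0"
      by (intro tendsto_mult_right_zero tendsto_add_zero)
  qed simp
  then show ?thesis by (rule LIMSEQ_imp_Suc)
qed

text \<open>Sum \<open>abs_err_increment_le\<close> over \<open>N\<close> consecutive coordinates,
  discard the nonnegative terms \<open>\<bar>err (Suc (n + i)) t\<bar>\<close> and
  \<open>ferr_int (n + N) t\<close>, then let \<open>N\<close> tend to infinity at fixed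
  \<open>t\<close>. The initial-error term does not depend on \<open>t\<close>.\<close>

lemma err_int_le:
  assumes t: "0 \<le> t"
  shows "real k * err_int (Suc n) t \<le> (\<Sum>i. \<bar>err (Suc (n + i)) 0\<bar>) + lam * ferr_int n t"
proof -
  have "real k * err_int (Suc n) t
      \<le> (\<Sum>i. \<bar>err (Suc (n + i)) 0\<bar>) + lam * ferr_int n t + real k * err_int (Suc n + N) t" for N
  proof -
    have "- (\<Sum>i<N. \<bar>err (Suc (n + i)) 0\<bar>)
        \<le> (\<Sum>i<N. \<bar>err (Suc (n + i)) t\<bar> - \<bar>err (Suc (n + i)) 0\<bar>)"
      by (simp add: sum_subtractf sum_nonneg)
    also have "\<dots> \<le> (\<Sum>i<N. lam * (ferr_int (n + i) t - ferr_int (n + Suc i) t)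
        - real k * (err_int (Suc n + i) t - err_int (Suc n + Suc i) t))"
      using abs_err_increment_le[OF t] by (intro sum_mono) simp
    also have "\<dots> = lam * (ferr_int n t - ferr_int (n + N) t)
        - real k * (err_int (Suc n) t - err_int (Suc n + N) t)"
      using sum_lessThan_telescope'[of "\<lambda>i. ferr_int (n + i) t" N]
        sum_lessThan_telescope'[of "\<lambda>i. err_int (Suc n + i) t" N]
      by (simp add: sum_subtractf flip: sum_distrib_left)
    also have "\<dots> \<le> lam * ferr_int n t - real k * (err_int (Suc n) t - err_int (Suc n + N) t)"
    proof -
      have "0 \<le> ferr_int (n + N) t"
        unfolding ferr_int_def
        by (intro Henstock_Kurzweil_Integration.integral_nonneg
            integrable_continuous_interval continuous_on_subset[OF continuous_abs_ferr]) auto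
      then show ?thesis using lam by simp
    qed
    finally have "- (\<Sum>i<N. \<bar>err (Suc (n + i)) 0\<bar>)
        \<le> lam * ferr_int n t - real k * (err_int (Suc n) t - err_int (Suc n + N) t)" .
    moreover have "(\<Sum>i<N. \<bar>err (Suc (n + i)) 0\<bar>) \<le> (\<Sum>i. \<bar>err (Suc (n + i)) 0\<bar>)"
      using summable_err_0 summable_iff_shift[of "\<lambda>j. \<bar>err j 0\<bar>" "Suc n"]
      by (intro sum_le_suminf) (auto simp: add_ac)
    ultimately show ?thesis by (simp add: algebra_simps)
  qed
  moreover have "(\<lambda>N. (\<Sum>i. \<bar>err (Suc (n + i)) 0\<bar>) + lam * ferr_int n t + real k * err_int (Suc n + N) t)
      \<longlonglongrightarrow> (\<Sum>i. \<bar>err (Suc (n + i)) 0\<bar>) + lam * ferr_int n t + real k * 0"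
    using LIMSEQ_ignore_initial_segment[OF err_int_tendsto_0[OF t], of "Suc n"]
    by (intro tendsto_intros) (simp add: add_ac)
  ultimately show ?thesis by (intro LIMSEQ_le_const[of _ _ "real k * err_int (Suc n) t"]) auto
qed

text \<open>Induction along the chain: coordinate 0 has no error, and \<open>ferr_le\<close> bounds
  the inflow \<open>ferr_int n t\<close> in \<open>err_int_le\<close> by a multiple of
  \<open>err_int n t\<close>.\<close>

lemma err_int_bounded: "\<exists>K. \<forall>t\<ge>0. err_int j t \<le> K"
proof (induction j)
  case 0
  have "err_int 0 t = 0" if "0 \<le> t" for t
    unfolding err_int_def using u_0
    by (intro integral_unique has_integral_is_0) (simp add: err_def)
  then show ?case by auto
next
  case (Suc n)
  then obtain K where K: "\<And>t. 0 \<le> t \<Longrightarrow> err_int n t \<le> K" by auto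
  have "err_int (Suc n) t \<le> ((\<Sum>i. \<bar>err (Suc (n + i)) 0\<bar>) + lam * (f_poly' L k 1 * K)) / real k"
    if t: "0 \<le> t" for t
  proof -
    have "ferr_int n t \<le> integral {0..t} (\<lambda>s. f_poly' L k 1 * \<bar>err n s\<bar>)"
      unfolding ferr_int_def
      by (intro integral_le integrable_continuous_interval continuous_on_mult_left ferr_le
          continuous_on_subset[OF continuous_abs_ferr] continuous_on_subset[OF continuous_abs_err]) auto
    also have "\<dots> = f_poly' L k 1 * err_int n t"
      by (simp add: err_int_def)
    also have "\<dots> \<le> f_poly' L k 1 * K"
      using K[OF t] f_poly'_nonneg[OF k, of 1] by (intro mult_left_mono) auto
    finally have "lam * ferr_int n t \<le> lam * (f_poly' L k 1 * K)"
      using lam by simp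
    with err_int_le[OF t, of n] show ?thesis
      using k by (simp add: field_simps)
  qed
  then show ?case by blast
qed

section \<open>Convergence to \<open>u_bar\<close>, coordinatewise and in \<open>rho\<close>\<close>

lemma u_lipschitz:
  assumes "0 \<le> s" "0 \<le> t"
  shows "\<bar>u s (Suc j) - u t (Suc j)\<bar> \<le> 2 * real k * \<bar>s - t\<bar>"
proof -
  have "norm (u s (Suc j) - u t (Suc j)) \<le> 2 * real k * norm (s - t)"
  proof (rule field_differentiable_bound[where S = "{0..}" and f = "\<lambda>t. u t (Suc j)"])
    fix r :: real assume "r \<in> {0..}"
    then have r: "0 \<le> r" by simp
    show "((\<lambda>t. u t (Suc j)) has_real_derivative
      lam * (f_poly L k (u r j) - f_poly L k (u r (Suc j))) - real k * (u r (Suc j) - u r (Suc (Suc j))))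
      (at r within {0..})"
      by (rule ode[OF r])
    \<comment> \<open>Each of the two fluxes in the equation has modulus at most \<open>k\<close>,
      whence the Lipschitz constant \<open>2 * real k\<close>.\<close>
    have "\<bar>lam * (f_poly L k (u r j) - f_poly L k (u r (Suc j)))\<bar> \<le> 1 * real k"
      unfolding abs_mult
      using f_poly_bounds[OF k bounds[OF r], of j] f_poly_bounds[OF k bounds[OF r], of "Suc j"] lam
      by (intro mult_mono) linarith+
    moreover have "\<bar>real k * (u r (Suc j) - u r (Suc (Suc j)))\<bar> \<le> real k * 1"
      unfolding abs_mult using bounds[OF r, of "Suc j"] bounds[OF r, of "Suc (Suc j)"]
      by (intro mult_mono) (auto simp: abs_le_iff)
    ultimately show "norm (lam * (f_poly L k (u r j) - f_poly L k (u r (Suc j)))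
        - real k * (u r (Suc j) - u r (Suc (Suc j)))) \<le> 2 * real k"
      by simp
  qed (use assms in auto)
  then show ?thesis by simp
qed

lemma err_tendsto_0: "(err j \<longlongrightarrow> 0) at_top"
proof (cases j)
  case 0
  have "\<forall>\<^sub>F t in at_top. err j t = 0"
    using eventually_ge_at_top[of 0] by eventually_elim (simp add: 0 err_def u_0)
  then show ?thesis by (rule tendsto_eventually)
next
  case (Suc i)
  obtain K where K: "\<And>t. 0 \<le> t \<Longrightarrow> err_int j t \<le> K"
    using err_int_bounded by auto
  have "((\<lambda>t. \<bar>err j t\<bar>) \<longlongrightarrow> 0) at_top"
  proof (rule barbalat)
    fix s t :: real assume st: "0 \<le> s" "s \<le> t"
    have "\<bar>err j s\<bar> - \<bar>err j t\<bar> \<le> \<bar>u s j - u t j\<bar>" by (simp add: err_def)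
    also have "\<dots> \<le> 2 * real k * (t - s)"
      using u_lipschitz[of s t i] st by (simp add: Suc)
    finally show "\<bar>err j s\<bar> - \<bar>err j t\<bar> \<le> 2 * real k * (t - s)" .
  qed (use k K continuous_abs_err in \<open>auto simp: err_int_def\<close>)
  then show ?thesis by (rule tendsto_rabs_zero_cancel)
qed

text \<open>Dominated convergence for series: coordinates lie in the unit interval, so the weights
  themselves form a summable majorant for all nonnegative times.\<close>

lemma rho_tendsto_0: "((\<lambda>t. rho (u t) (u_bar L k lam)) \<longlongrightarrow> 0) at_top"
proof -
  have "((\<lambda>t. \<Sum>j. \<bar>u t (Suc j) - u_bar L k lam (Suc j)\<bar> / 2 ^ Suc j) \<longlongrightarrow> (\<Sum>j. 0)) at_top"
  proof (rule tannerys_theorem[THEN conjunct2, THEN conjunct2])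
    show "((\<lambda>t. \<bar>u t (Suc j) - u_bar L k lam (Suc j)\<bar> / 2 ^ Suc j) \<longlongrightarrow> 0) at_top" for j
      using tendsto_rabs_zero[OF err_tendsto_0[of "Suc j"]] unfolding err_def
      by (rule tendsto_divide_zero)
    have "norm (\<bar>u t (Suc j) - u_bar L k lam (Suc j)\<bar> / 2 ^ Suc j) \<le> (1 / 2) ^ Suc j" if "0 \<le> t" for t j
      using bounds[OF that, of "Suc j"] u_bar_range[of "Suc j"]
      by (simp add: power_one_over divide_right_mono abs_le_iff del: u_bar.simps power_Suc)
    then show "\<forall>\<^sub>F (j, t) in sequentially \<times>\<^sub>F at_top.
        norm (\<bar>u t (Suc j) - u_bar L k lam (Suc j)\<bar> / 2 ^ Suc j) \<le> (1 / 2) ^ Suc j"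
      unfolding eventually_prod_filter
      using eventually_ge_at_top[of "0 :: real"] by (intro exI[of _ "\<lambda>_. True"] exI[of _ "\<lambda>t. 0 \<le> t"]) auto
    show "summable (\<lambda>j. (1 / 2 :: real) ^ Suc j)"
      by (simp add: summable_Suc_iff summable_geometric del: power_Suc)
  qed simp
  then show ?thesis by (simp add: rho_def)
qed

end

theorem theorem2p3:
  fixes L k :: nat and lam :: real
    and g :: "nat \<Rightarrow> real" and u :: "real \<Rightarrow> nat \<Rightarrow> real"
  assumes "1 \<le> k" and "k < L" and "0 < lam" and "lam < 1"
    and "g \<in> U" and "is_solution L k lam g u"
  shows "(\<forall>t\<ge>0. u t \<in> U)
    \<and> (\<forall>j. ((\<lambda>t. u t j - u_bar L k lam j) \<longlongrightarrow> 0) at_top)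
    \<and> ((\<lambda>t. rho (u t) (u_bar L k lam)) \<longlongrightarrow> 0) at_top
    \<and> is_fixed_point L k lam (u_bar L k lam)
    \<and> (\<forall>p. is_fixed_point L k lam p \<longrightarrow> p = u_bar L k lam)"
proof -
  interpret solution L k lam g u
    using assms by unfold_locales
  have "p = u_bar L k lam" if "is_fixed_point L k lam p" for p
  proof
    fix j
    \<comment> \<open>The constant function is a solution with initial value \<open>p\<close>, so
      its error tends to 0; being constant in time, the error is 0.\<close>
    interpret p: solution L k lam p "\<lambda>_. p"
      using that assms(1-4)
      by unfold_locales (auto simp: is_fixed_point_def is_solution_def U_def)
    have "((\<lambda>_ :: real. p j - u_bar L k lam j) \<longlongrightarrow> 0) at_top"
      using p.err_tendsto_0[of j] unfolding p.err_def .
    then show "p j = u_bar L k lam j"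
      by (simp add: tendsto_const_iff del: u_bar.simps)
  qed
  then show ?thesis
    using in_U err_tendsto_0 rho_tendsto_0 is_fixed_point_u_bar[OF assms(1-4)]
    unfolding err_def by blast
qed

end
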